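(* Let $(M,g)$ be the Robinson–Trautman spacetime with coordinates $(t,r,x,y)$, constants $a,b,d\in\mathbb R$ and function $f=f(x,y)$, and let $F_1=f_x^2+f_y^2-f(f_{xx}+f_{yy})$. Put $$F_8=(-2a+4br+F_1)\{16b^2r^2+(2a-8br-F_1)^2\}-2(-4br+2a+F_1)(-2a+8br+F_1)(1-4br),$$ $$F_9=4af_x-8brf_x-2f_y^2f_x+ff_{yy}f_x-2f_x^3+2ff_yf_{xy}-f^2f_{xyy}+3ff_xf_{xx}-f^2f_{xxx},$$ $$\begin{aligned}F_{10}=2\big[&-6adf_x+84bdrf_x-28abr^2f_x+8b^2r^3f_x+2br^2f_x\{7F_1+2f(f_{yy}-f_{xx})\}\\&+4br^2f^2(f_{xxx}+f_{xyy})+3df_xF_1\big],\end{aligned}$$ $$\begin{aligned}F_{12}=&-18drf_x+8ar^2f_x-4br^3f_x-4r^2f_y^2f_x+3r^2ff_{yy}f_x-4r^2f_x^3\\&+2r^2ff_yf_{xy}-r^2f^2f_{xyy}+5r^2ff_xf_{xx}-r^2f^2f_{xxx}.\end{aligned}$$ If $F_1-2a+4br\neq0$, $F_8\neq0$ and $F_9=F_{10}=F_{12}=0$ on all of $M$, then the spacetime possesses Weyl projective curvature collineation with respect to $\xi=\frac{\partial}{\partial x}$, i.e. $\mathscr L_\xi P=0$.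
   Context: Robinson–Trautman (RT) spacetime: $a,b,d\in\mathbb R$ are constants; $M=I\times J\times\Omega$ with coordinates $(x^1,x^2,x^3,x^4)=(t,r,x,y)$, where $I\subset\mathbb R$ and $J\subset\mathbb R\setminus\{0\}$ are nonempty open intervals and $\Omega\subset\mathbb R^2$ is open, connected and nonempty; $f:\Omega\to\mathbb R$ is smooth and nowhere vanishing, with subscripts denoting partial derivatives; the metric is $$g=-2\Big(a-2br-\frac dr\Big)dt^2+2\,dt\,dr-\frac{r^2}{f^2}(dx^2+dy^2).$$ ($2\,dt\,dr$ means $g_{12}=g_{21}=1$.) Curvature conventions: with $\Gamma$ the Levi-Civita connection coefficients, $R_{pqrs}=g_{p\alpha}(\partial_r\Gamma^\alpha_{qs}-\partial_s\Gamma^\alpha_{qr}+\Gamma^\beta_{qs}\Gamma^\alpha_{\beta r}-\Gamma^\beta_{qr}\Gamma^\alpha_{\beta s})$ and $S_{qr}=g^{ps}R_{pqrs}$. The Weyl projective $(0,4)$ curvature tensor (dimension 4) is $P_{pqrs}=R_{pqrs}-\frac13(g_{ps}S_{qr}-g_{qs}S_{pr})$; $\mathscr L_\xi$ is the Lie derivative of the $(0,4)$ tensor. *)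

theory Defs
  imports "HOL-Analysis.Analysis"
begin

definition pderiv_at :: "'n::finite \<Rightarrow> (real ^ 'n \<Rightarrow> real) \<Rightarrow> real ^ 'n \<Rightarrow> real" where
  "pderiv_at i u p = deriv (\<lambda>h. u (p + h *\<^sub>R axis i 1)) 0"

text \<open>The two notions below are meant for open \<open>S\<close>.\<close>

primrec Ck_on :: "nat \<Rightarrow> (real ^ 'n::finite) set \<Rightarrow> (real ^ 'n \<Rightarrow> real) \<Rightarrow> bool" where
  "Ck_on 0 S u = continuous_on S u"
| "Ck_on (Suc k) S u = (u differentiable_on S \<and> (\<forall>i. Ck_on k S (pderiv_at i u)))"

definition smooth_on :: "(real ^ 'n::finite) set \<Rightarrow> (real ^ 'n \<Rightarrow> real) \<Rightarrow> bool" where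
  "smooth_on S u \<longleftrightarrow> (\<forall>k. Ck_on k S u)"

text \<open>A metric \<open>g\<close> is given by its matrix of components, \<open>g p $ i $ j\<close> being the
  \<open>(i, j)\<close> component at the point \<open>p\<close>. As usual in local coordinates, values of
  \<open>g\<close> outside the (open) chart do not influence the quantities below at points of the chart.\<close>

text \<open>\<open>christoffel g i j k\<close> is the coefficient with upper index \<open>i\<close> and
  lower indices \<open>j\<close>, \<open>k\<close>.\<close>

definition christoffel ::
    "(real ^ 'n \<Rightarrow> real ^ 'n ^ 'n::finite) \<Rightarrow> 'n \<Rightarrow> 'n \<Rightarrow> 'n \<Rightarrow> real ^ 'n \<Rightarrow> real" where
  "christoffel g i j k p =
     (\<Sum>l\<in>UNIV. matrix_inv (g p) $ i $ l *
        (pderiv_at j (\<lambda>x. g x $ l $ k) p + pderiv_at k (\<lambda>x. g x $ l $ j) p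
         - pderiv_at l (\<lambda>x. g x $ j $ k) p)) / 2"

text \<open>\<open>riemann g p q r s\<close> is the fully covariant component \<open>R\<^sub>p\<^sub>q\<^sub>r\<^sub>s\<close>;
  \<open>p\<close> is the lowered index and \<open>r\<close>, \<open>s\<close> are the antisymmetric pair of derivative indices.
  The Ricci tensor contracts the first and the last index.\<close>

definition riemann ::
    "(real ^ 'n \<Rightarrow> real ^ 'n ^ 'n::finite) \<Rightarrow> 'n \<Rightarrow> 'n \<Rightarrow> 'n \<Rightarrow> 'n \<Rightarrow> real ^ 'n \<Rightarrow> real" where
  "riemann g p q r s x =
     (\<Sum>\<alpha>\<in>UNIV. g x $ p $ \<alpha> *
        (pderiv_at r (christoffel g \<alpha> q s) x - pderiv_at s (christoffel g \<alpha> q r) x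
         + (\<Sum>\<beta>\<in>UNIV. christoffel g \<beta> q s x * christoffel g \<alpha> \<beta> r x)
         - (\<Sum>\<beta>\<in>UNIV. christoffel g \<beta> q r x * christoffel g \<alpha> \<beta> s x)))"

definition ricci ::
    "(real ^ 'n \<Rightarrow> real ^ 'n ^ 'n::finite) \<Rightarrow> 'n \<Rightarrow> 'n \<Rightarrow> real ^ 'n \<Rightarrow> real" where
  "ricci g q r x = (\<Sum>p\<in>UNIV. \<Sum>s\<in>UNIV. matrix_inv (g x) $ p $ s * riemann g p q r s x)"

text \<open>In dimension \<open>n\<close> the factor is \<open>1 / (n - 1)\<close>; only \<open>n = 4\<close> is needed.\<close>

definition weyl_projective ::
    "(real ^ 4 \<Rightarrow> real ^ 4 ^ 4) \<Rightarrow> 4 \<Rightarrow> 4 \<Rightarrow> 4 \<Rightarrow> 4 \<Rightarrow> real ^ 4 \<Rightarrow> real" where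
  "weyl_projective g p q r s x =
     riemann g p q r s x - 1/3 * (g x $ p $ s * ricci g q r x - g x $ q $ s * ricci g p r x)"

definition lie_derivative ::
    "(real ^ 'n \<Rightarrow> real ^ 'n::finite) \<Rightarrow> ('n \<Rightarrow> 'n \<Rightarrow> 'n \<Rightarrow> 'n \<Rightarrow> real ^ 'n \<Rightarrow> real)
      \<Rightarrow> 'n \<Rightarrow> 'n \<Rightarrow> 'n \<Rightarrow> 'n \<Rightarrow> real ^ 'n \<Rightarrow> real" where
  "lie_derivative X T p q r s x =
     (\<Sum>\<alpha>\<in>UNIV. X x $ \<alpha> * pderiv_at \<alpha> (T p q r s) x
        + T \<alpha> q r s x * pderiv_at p (\<lambda>y. X y $ \<alpha>) x
        + T p \<alpha> r s x * pderiv_at q (\<lambda>y. X y $ \<alpha>) x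
        + T p q \<alpha> s x * pderiv_at r (\<lambda>y. X y $ \<alpha>) x
        + T p q r \<alpha> x * pderiv_at s (\<lambda>y. X y $ \<alpha>) x)"

definition weyl_projective_collineation_on ::
    "(real ^ 4) set \<Rightarrow> (real ^ 4 \<Rightarrow> real ^ 4 ^ 4) \<Rightarrow> (real ^ 4 \<Rightarrow> real ^ 4) \<Rightarrow> bool" where
  "weyl_projective_collineation_on M g X \<longleftrightarrow>
     (\<forall>x\<in>M. \<forall>p q r s. lie_derivative X (weyl_projective g) p q r s x = 0)"

text \<open>Coordinates on \<open>real ^ 4\<close>: indices 1, 2, 3, 4 are \<open>t\<close>, \<open>r\<close>, \<open>x\<close>, \<open>y\<close>
  (the index type is arithmetic modulo 4, so the fourth index also equals 0).
  The function \<open>f\<close> lives on \<open>real ^ 2\<close>, where indices 1, 2 are \<open>x\<close>, \<open>y\<close>.\<close>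

definition xy_part :: "real ^ 4 \<Rightarrow> real ^ 2" where
  "xy_part p = vector [p $ 3, p $ 4]"

definition RT_domain :: "real set \<Rightarrow> real set \<Rightarrow> (real ^ 2) set \<Rightarrow> (real ^ 4) set" where
  "RT_domain I J \<Omega> = {p. p $ 1 \<in> I \<and> p $ 2 \<in> J \<and> xy_part p \<in> \<Omega>}"

definition RT_metric ::
    "real \<Rightarrow> real \<Rightarrow> real \<Rightarrow> (real ^ 2 \<Rightarrow> real) \<Rightarrow> real ^ 4 \<Rightarrow> real ^ 4 ^ 4" where
  "RT_metric a b d f p =
     (let r = p $ 2; h = - r\<^sup>2 / (f (xy_part p))\<^sup>2 in
      vector [vector [- 2 * (a - 2 * b * r - d / r), 1, 0, 0],
              vector [1, 0, 0, 0],
              vector [0, 0, h, 0],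
              vector [0, 0, 0, h]])"

abbreviation dx :: "(real ^ 2 \<Rightarrow> real) \<Rightarrow> real ^ 2 \<Rightarrow> real" where "dx \<equiv> pderiv_at 1"
abbreviation dy :: "(real ^ 2 \<Rightarrow> real) \<Rightarrow> real ^ 2 \<Rightarrow> real" where "dy \<equiv> pderiv_at 2"

definition F1 :: "(real ^ 2 \<Rightarrow> real) \<Rightarrow> real ^ 4 \<Rightarrow> real" where
  "F1 f p =
     (let z = xy_part p
      in (dx f z)\<^sup>2 + (dy f z)\<^sup>2 - f z * (dx (dx f) z + dy (dy f) z))"

definition F8 :: "real \<Rightarrow> real \<Rightarrow> (real ^ 2 \<Rightarrow> real) \<Rightarrow> real ^ 4 \<Rightarrow> real" where
  "F8 a b f p =
     (let r = p $ 2; F = F1 f p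
      in (- 2*a + 4*b*r + F) * (16*b\<^sup>2*r\<^sup>2 + (2*a - 8*b*r - F)\<^sup>2)
         - 2 * (- 4*b*r + 2*a + F) * (- 2*a + 8*b*r + F) * (1 - 4*b*r))"

definition F9 :: "real \<Rightarrow> real \<Rightarrow> (real ^ 2 \<Rightarrow> real) \<Rightarrow> real ^ 4 \<Rightarrow> real" where
  "F9 a b f p =
     (let r = p $ 2; z = xy_part p; f0 = f z; fx = dx f z; fy = dy f z;
          fxx = dx (dx f) z; fxy = dy (dx f) z; fyy = dy (dy f) z;
          fxxx = dx (dx (dx f)) z; fxyy = dy (dy (dx f)) z
      in 4*a*fx - 8*b*r*fx - 2*fy\<^sup>2*fx + f0*fyy*fx - 2*fx^3 + 2*f0*fy*fxy
         - f0\<^sup>2*fxyy + 3*f0*fx*fxx - f0\<^sup>2*fxxx)"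

definition F10 :: "real \<Rightarrow> real \<Rightarrow> real \<Rightarrow> (real ^ 2 \<Rightarrow> real) \<Rightarrow> real ^ 4 \<Rightarrow> real" where
  "F10 a b d f p =
     (let r = p $ 2; z = xy_part p; F = F1 f p; f0 = f z; fx = dx f z;
          fxx = dx (dx f) z; fyy = dy (dy f) z;
          fxxx = dx (dx (dx f)) z; fxyy = dy (dy (dx f)) z
      in 2 * (- 6*a*d*fx + 84*b*d*r*fx - 28*a*b*r\<^sup>2*fx + 8*b\<^sup>2*r^3*fx
              + 2*b*r\<^sup>2*fx * (7*F + 2*f0*(fyy - fxx))
              + 4*b*r\<^sup>2*f0\<^sup>2*(fxxx + fxyy) + 3*d*fx*F))"

definition F12 :: "real \<Rightarrow> real \<Rightarrow> real \<Rightarrow> (real ^ 2 \<Rightarrow> real) \<Rightarrow> real ^ 4 \<Rightarrow> real" where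
  "F12 a b d f p =
     (let r = p $ 2; z = xy_part p; f0 = f z; fx = dx f z; fy = dy f z;
          fxx = dx (dx f) z; fxy = dy (dx f) z; fyy = dy (dy f) z;
          fxxx = dx (dx (dx f)) z; fxyy = dy (dy (dx f)) z
      in - 18*d*r*fx + 8*a*r\<^sup>2*fx - 4*b*r^3*fx - 4*r\<^sup>2*fy\<^sup>2*fx + 3*r\<^sup>2*f0*fyy*fx
         - 4*r\<^sup>2*fx^3 + 2*r\<^sup>2*f0*fy*fxy - r\<^sup>2*f0\<^sup>2*fxyy + 5*r\<^sup>2*f0*fx*fxx
         - r\<^sup>2*f0\<^sup>2*fxxx)"

end

theory Submission
  imports Defs
begin

text \<open>
  The hypotheses force \<open>f\<close> to be locally independent of \<open>x\<close>, so \<open>\<partial>\<^sub>x\<close> is a Killing field of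
  the metric and every tensor built naturally from the metric is invariant under its flow; no
  curvature component has to be computed.

  At a fixed point of \<open>\<Omega>\<close> the conditions \<open>F\<^sub>9 = 0\<close> and \<open>F\<^sub>1\<^sub>2 = 0\<close> are polynomial identities
  in the coordinate \<open>r\<close>, which ranges over an interval. Suppose \<open>f\<^sub>x \<noteq> 0\<close> there. The coefficient of
  \<open>r\<close> in \<open>F\<^sub>9\<close> is \<open>-8 b f\<^sub>x\<close>, so \<open>b = 0\<close>. The constant coefficient of \<open>F\<^sub>9\<close> and the coefficient of
  \<open>r\<^sup>2\<close> in \<open>F\<^sub>1\<^sub>2\<close> then both vanish, and they differ by \<open>2 f\<^sub>x (2 a - F\<^sub>1)\<close>. Hence \<open>F\<^sub>1 = 2 a\<close>,
  which contradicts \<open>F\<^sub>1 - 2 a + 4 b r \<noteq> 0\<close> (lemma \<open>RT_conditions_imp_fx_zero\<close>).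

  Therefore \<open>f\<close>, and with it the matrix of metric components, does not change under small
  translations in the \<open>x\<close> direction. The projective curvature commutes with translations and
  depends only on the germ of the metric, so its components are also unchanged
  (lemma \<open>weyl_projective_translation_invariant\<close>); along the constant field \<open>\<partial>\<^sub>x\<close> the Lie derivative
  is the partial derivative of these components.
\<close>

section \<open>Locality and translation equivariance of the curvature\<close>

lemma pderiv_at_cong_open:
  assumes "open U" "p \<in> U" "\<And>x. x \<in> U \<Longrightarrow> u x = v x"
  shows "pderiv_at i u p = pderiv_at i v p"
proof -
  have "((\<lambda>h. p + h *\<^sub>R axis i 1) \<longlongrightarrow> p + 0 *\<^sub>R axis i 1) (nhds (0::real))"
    by (intro tendsto_intros filterlim_ident)
  then have "eventually (\<lambda>h. p + h *\<^sub>R axis i 1 \<in> U) (nhds (0::real))"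
    using assms(1,2) by (auto elim: topological_tendstoD)
  then have "eventually (\<lambda>h. u (p + h *\<^sub>R axis i 1) = v (p + h *\<^sub>R axis i 1)) (nhds (0::real))"
    by eventually_elim (rule assms(3))
  then show ?thesis
    unfolding pderiv_at_def by (intro deriv_cong_ev) auto
qed

lemma pderiv_at_translate: "pderiv_at i (\<lambda>x. u (x + v)) p = pderiv_at i u (p + v)"
  by (simp add: pderiv_at_def add_ac)

lemma christoffel_cong_open:
  assumes "open U" "p \<in> U" "\<And>x. x \<in> U \<Longrightarrow> g x = g' x"
  shows "christoffel g i j k p = christoffel g' i j k p"
proof -
  have "pderiv_at m (\<lambda>x. g x $ l $ n) p = pderiv_at m (\<lambda>x. g' x $ l $ n) p" for m l n
    using assms by (intro pderiv_at_cong_open[of U]) auto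
  then show ?thesis
    by (simp add: christoffel_def assms)
qed

lemma christoffel_translate:
  "christoffel (\<lambda>x. g (x + v)) i j k = (\<lambda>p. christoffel g i j k (p + v))"
  by (rule ext) (simp add: christoffel_def pderiv_at_translate[of _ "\<lambda>x. g x $ _ $ _"])

lemma riemann_cong_open:
  assumes "open U" "x \<in> U" "\<And>x. x \<in> U \<Longrightarrow> g x = g' x"
  shows "riemann g p q r s x = riemann g' p q r s x"
proof -
  have "pderiv_at m (christoffel g i j k) x = pderiv_at m (christoffel g' i j k) x" for m i j k
    using assms by (intro pderiv_at_cong_open[of U] christoffel_cong_open[of U]) auto
  then show ?thesis
    by (simp add: riemann_def assms christoffel_cong_open[OF assms])
qed

lemma riemann_translate:
  "riemann (\<lambda>x. g (x + v)) p q r s x = riemann g p q r s (x + v)"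
  by (simp add: riemann_def christoffel_translate pderiv_at_translate)

lemma weyl_projective_cong_open:
  assumes "open U" "x \<in> U" "\<And>x. x \<in> U \<Longrightarrow> g x = g' x"
  shows "weyl_projective g p q r s x = weyl_projective g' p q r s x"
  by (simp add: weyl_projective_def ricci_def assms riemann_cong_open[OF assms])

lemma weyl_projective_translate:
  "weyl_projective (\<lambda>x. g (x + v)) p q r s x = weyl_projective g p q r s (x + v)"
  by (simp add: weyl_projective_def ricci_def riemann_translate)

text \<open>A translation that preserves the metric components near a point identifies the germs of
  the metric at the point and at its image.\<close>

lemma weyl_projective_translation_invariant:
  assumes "open U" "x \<in> U" "\<And>x. x \<in> U \<Longrightarrow> g (x + v) = g x"
  shows "weyl_projective g p q r s (x + v) = weyl_projective g p q r s x"
  using weyl_projective_cong_open[of U x "\<lambda>x. g (x + v)" g p q r s] assms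
  by (simp add: weyl_projective_translate)

lemma lie_derivative_coordinate_field:
  "lie_derivative (\<lambda>_. axis i 1) T p q r s x = pderiv_at i (T p q r s) x"
proof -
  have "pderiv_at j (\<lambda>y. axis i (1::real) $ k) x = 0" for j k
    by (simp add: pderiv_at_def)
  then have "lie_derivative (\<lambda>_. axis i 1) T p q r s x =
      (\<Sum>k\<in>UNIV. if k = i then pderiv_at k (T p q r s) x else 0)"
    unfolding lie_derivative_def by (intro sum.cong) (auto simp: axis_def)
  then show ?thesis
    by simp
qed

section \<open>Functions with vanishing partial derivative\<close>

lemma pderiv_at_zero_imp_translation_invariant:
  fixes u :: "real ^ 'n::finite \<Rightarrow> real"
  assumes "open S" "u differentiable_on S" "\<And>z. z \<in> S \<Longrightarrow> pderiv_at i u z = 0"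
    and "ball z e \<subseteq> S" "\<bar>h\<bar> < e"
  shows "u (z + h *\<^sub>R axis i 1) = u z"
proof -
  let ?w = "\<lambda>s. u (z + s *\<^sub>R axis i 1)"
  have "DERIV ?w s :> 0" if "\<bar>s\<bar> < e" for s
  proof -
    let ?y = "z + s *\<^sub>R axis i (1::real)"
    have "dist z ?y = \<bar>s\<bar>"
      by (simp add: dist_norm norm_axis_1)
    then have y: "?y \<in> S"
      using assms(4) that by auto
    then have "u differentiable (at ?y)"
      using assms(1,2) differentiable_on_eq_differentiable_at by blast
    moreover have "(\<lambda>h. ?y + h *\<^sub>R axis i (1::real)) differentiable (at 0)"
      by (intro derivative_intros)
    ultimately have "(\<lambda>h. u (?y + h *\<^sub>R axis i 1)) differentiable (at 0)"
      using differentiable_chain_at[of "\<lambda>h. ?y + h *\<^sub>R axis i (1::real)" 0 u]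
      by (simp add: o_def)
    then have "DERIV (\<lambda>h. u (?y + h *\<^sub>R axis i 1)) 0 :> pderiv_at i u ?y"
      unfolding pderiv_at_def
      by (metis DERIV_imp_deriv real_differentiableE)
    then have "DERIV (\<lambda>h. ?w (h + s)) 0 :> 0"
      using assms(3)[OF y] by (simp add: algebra_simps)
    then show ?thesis
      using DERIV_shift[of ?w 0 0 s] by simp
  qed
  then have "?w h = ?w 0"
    using assms(5) by (intro DERIV_isconst3[of "-e" e]) auto
  then show ?thesis
    by simp
qed

section \<open>The Robinson--Trautman metric\<close>

lemma vector_4:
  fixes t r x y :: "'a::zero"
  shows "(vector [t, r, x, y] :: 'a ^ 4) $ 1 = t"
    and "(vector [t, r, x, y] :: 'a ^ 4) $ 2 = r"
    and "(vector [t, r, x, y] :: 'a ^ 4) $ 3 = x"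
    and "(vector [t, r, x, y] :: 'a ^ 4) $ 4 = y"
  by (simp_all add: vector_def)

lemma xy_part_translate_x: "xy_part (p + h *\<^sub>R axis 3 1) = xy_part p + h *\<^sub>R axis 1 1"
  by (simp add: xy_part_def vec_eq_iff forall_2 axis_def)

lemma continuous_on_xy_part: "continuous_on A xy_part"
proof -
  have "continuous_on A (\<lambda>p. \<chi> i. if i = 1 then p $ 3 else p $ 4 :: real ^ 2)"
  proof (intro continuous_intros)
    show "continuous_on A (\<lambda>p. if i = 1 then p $ 3 else p $ 4)" for i :: 2
      by (cases "i = 1") (auto intro: continuous_intros)
  qed
  moreover have "xy_part = (\<lambda>p. \<chi> i. if i = 1 then p $ 3 else p $ 4)"
    by (simp add: fun_eq_iff xy_part_def vec_eq_iff forall_2)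
  ultimately show ?thesis
    by metis
qed

lemma RT_metric_translate_x:
  assumes "f (xy_part p + h *\<^sub>R axis 1 1) = f (xy_part p)"
  shows "RT_metric a b d f (p + h *\<^sub>R axis 3 1) = RT_metric a b d f p"
proof -
  have "(p + h *\<^sub>R axis 3 1) $ 2 = p $ 2"
    by (simp add: axis_def)
  then show ?thesis
    unfolding RT_metric_def xy_part_translate_x assms by (simp only:)
qed

text \<open>Two values of \<open>r\<close> suffice to separate the coefficients: \<open>F\<^sub>9\<close> is affine in \<open>r\<close>, and once
  \<open>b = 0\<close> so is \<open>F\<^sub>1\<^sub>2 / r\<close>.\<close>

lemma RT_conditions_imp_fx_zero:
  assumes "xy_part p = z" "xy_part p' = z"
    and "p $ 2 \<noteq> p' $ 2" "p $ 2 \<noteq> 0" "p' $ 2 \<noteq> 0"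
    and "F1 f p - 2 * a + 4 * b * p $ 2 \<noteq> 0"
    and "F9 a b f p = 0" "F9 a b f p' = 0" "F12 a b d f p = 0" "F12 a b d f p' = 0"
  shows "dx f z = 0"
proof (rule ccontr)
  assume fx: "dx f z \<noteq> 0"
  define C9 where "C9 = 4*a*dx f z - 2*(dy f z)\<^sup>2*dx f z + f z*dy (dy f) z*dx f z - 2*(dx f z)^3
    + 2*f z*dy f z*dy (dx f) z - (f z)\<^sup>2*dy (dy (dx f)) z + 3*f z*dx f z*dx (dx f) z
    - (f z)\<^sup>2*dx (dx (dx f)) z"
  define C12 where "C12 = 8*a*dx f z - 4*(dy f z)\<^sup>2*dx f z + 3*f z*dy (dy f) z*dx f z
    - 4*(dx f z)^3 + 2*f z*dy f z*dy (dx f) z - (f z)\<^sup>2*dy (dy (dx f)) z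
    + 5*f z*dx f z*dx (dx f) z - (f z)\<^sup>2*dx (dx (dx f)) z"
  have F9: "F9 a b f q = C9 - 8*b*q$2*dx f z" if "xy_part q = z" for q
    by (simp add: F9_def C9_def Let_def that)
  have F12: "F12 a b d f q = q$2 * (q$2*C12 - 18*d*dx f z - 4*b*(q$2)\<^sup>2*dx f z)"
    if "xy_part q = z" for q
    by (simp add: F12_def C12_def Let_def that algebra_simps power2_eq_square power3_eq_cube)
  have difference: "C12 - C9 = 2 * dx f z * (2*a - F1 f p)"
    by (simp add: C9_def C12_def F1_def Let_def assms(1) algebra_simps power2_eq_square
        power3_eq_cube)
  have "8 * b * dx f z * (p$2 - p'$2) = 0"
    using F9[OF assms(1)] F9[OF assms(2)] assms(7,8) by (simp add: algebra_simps)
  then have b: "b = 0"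
    using fx assms(3) by simp
  have "C9 = 0"
    using F9[OF assms(1)] assms(7) b by simp
  moreover have "p$2*C12 = 18*d*dx f z" "p'$2*C12 = 18*d*dx f z"
    using F12[OF assms(1)] F12[OF assms(2)] assms(4,5,9,10) b by simp_all
  then have "C12 = 0"
    using assms(3) by (metis mult_right_cancel)
  ultimately have "F1 f p = 2 * a"
    using difference fx by simp
  then show False
    using assms(6) b by simp
qed

theorem corollary4p10:
  fixes a b d :: real
    and I J :: "real set"
    and \<Omega> :: "(real ^ 2) set"
    and f :: "real ^ 2 \<Rightarrow> real"
    and M :: "(real ^ 4) set"
  assumes "open I" "is_interval I" "I \<noteq> {}"
    and "open J" "is_interval J" "J \<noteq> {}" "0 \<notin> J"
    and "open \<Omega>" "connected \<Omega>" "\<Omega> \<noteq> {}"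
    and "smooth_on \<Omega> f" "\<forall>z\<in>\<Omega>. f z \<noteq> 0"
    and "M = RT_domain I J \<Omega>"
    and "\<forall>p\<in>M. F1 f p - 2 * a + 4 * b * p $ 2 \<noteq> 0"
    and "\<forall>p\<in>M. F8 a b f p \<noteq> 0"
    and "\<forall>p\<in>M. F9 a b f p = 0 \<and> F10 a b d f p = 0 \<and> F12 a b d f p = 0"
  shows "weyl_projective_collineation_on M (RT_metric a b d f) (\<lambda>_. axis 3 1)"
proof -
  have fx: "dx f z = 0" if "z \<in> \<Omega>" for z
  proof -
    obtain t where t: "t \<in> I"
      using assms(3) by auto
    have "infinite J"
      using assms(4,6) finite_imp_not_open by blast
    then obtain r r' where r: "r \<in> J" "r' \<in> J" "r \<noteq> r'"
      by (metis finite.simps insertI1 is_singletonI' is_singleton_def)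
    define P where "P = (\<lambda>r. vector [t, r, z$1, z$2] :: real ^ 4)"
    have P: "P r $ 2 = r" "xy_part (P r) = z" for r
      by (simp_all add: P_def vector_4 xy_part_def vec_eq_iff forall_2)
    have M: "P r \<in> M" if "r \<in> J" for r
      using that t \<open>z \<in> \<Omega>\<close> P by (simp add: assms(13) RT_domain_def) (simp add: P_def vector_4)
    have "r \<noteq> 0" "r' \<noteq> 0"
      using r assms(7) by auto
    with P r show ?thesis
      using bspec[OF assms(14) M[OF r(1)]] bspec[OF assms(16) M[OF r(1)]]
        bspec[OF assms(16) M[OF r(2)]]
      by (intro RT_conditions_imp_fx_zero[of "P r" z "P r'" f a b d]) simp_all
  qed
  have diff: "f differentiable_on \<Omega>"
    using assms(11) unfolding smooth_on_def by (metis Ck_on.simps(2))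
  have "pderiv_at 3 (weyl_projective (RT_metric a b d f) p q r s) x = 0"
    if "x \<in> M" for x p q r s
  proof -
    let ?W = "weyl_projective (RT_metric a b d f) p q r s"
    have "xy_part x \<in> \<Omega>"
      using that by (simp add: assms(13) RT_domain_def)
    then obtain e where e: "e > 0" "ball (xy_part x) e \<subseteq> \<Omega>"
      using assms(8) open_contains_ball by blast
    \<comment> \<open>Half the radius leaves room to translate every point of the neighbourhood by up to
      \<open>e / 2\<close>.\<close>
    define U where "U = xy_part -` ball (xy_part x) (e / 2)"
    have U: "open U" "x \<in> U"
      using e(1) by (auto simp: U_def intro!: open_vimage continuous_on_xy_part)
    have "?W (x + h *\<^sub>R axis 3 1) = ?W x" if h: "\<bar>h\<bar> < e / 2" for h
    proof (rule weyl_projective_translation_invariant[OF U])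
      fix y assume "y \<in> U"
      then have "ball (xy_part y) (e / 2) \<subseteq> ball (xy_part x) e"
        by (intro ball_subset_ball_iff[THEN iffD2]) (auto simp: U_def dist_commute)
      then have "f (xy_part y + h *\<^sub>R axis 1 1) = f (xy_part y)"
        using e(2) h
        by (intro pderiv_at_zero_imp_translation_invariant[OF assms(8) diff fx, of _ "e / 2"]) auto
      then show "RT_metric a b d f (y + h *\<^sub>R axis 3 1) = RT_metric a b d f y"
        by (rule RT_metric_translate_x)
    qed
    then have "eventually (\<lambda>h. ?W (x + h *\<^sub>R axis 3 1) = ?W x) (nhds 0)"
      using e(1) by (auto simp: eventually_nhds_metric dist_norm intro!: exI[of _ "e / 2"])
    then have "pderiv_at 3 ?W x = deriv (\<lambda>_. ?W x) 0"
      unfolding pderiv_at_def by (intro deriv_cong_ev) auto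
    then show ?thesis
      by simp
  qed
  then show ?thesis
    by (simp add: weyl_projective_collineation_on_def lie_derivative_coordinate_field)
qed

end
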